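(* Let $\mathcal{C}\subseteq\mathbb{R}^d$ be a polytope of diameter $\delta>0$, let $f\colon\mathcal{C}\to\mathbb{R}$ be an $\alpha_f$-strongly convex and $L$-smooth function with unique minimizer $x^*\in\operatorname{argmin}_{x\in\mathcal{C}}f(x)$. Suppose that $x^*$ is contained in the relative interior of an at least one-dimensional face $\mathcal{C}^*$ of $\mathcal{C}$ and that there exist $\beta,\kappa>0$ such that (a) $\langle\nabla f(x^* ),p-x^*\rangle\ge\kappa$ for every vertex $p\in\operatorname{vert}(\mathcal{C})\setminus\mathcal{C}^*$, and $\langle\nabla f(x^* ),p-x^*\rangle=0$ for every $p\in\operatorname{vert}(\mathcal{C}^* )$; (b) $\emptyset\ne B_\beta(x^* )\cap\operatorname{aff}(\mathcal{C}^* )\subseteq\mathcal{C}$. Let $M=\max_{x\in\mathcal{C}}\|\nabla f(x)\|_2$, $S=\max\left\{\left\lceil\frac{16L\delta^2}{\alpha_f\beta^2}\right\rceil,\left\lceil\frac{64L^3\delta^4}{\alpha_f\kappa^2}\right\rceil\right\}$, $T\in\mathbb{N}$, and $\eta_t=\frac{4}{t+4}$ for all $t\in\mathbb{Z}$. Then, for the iterates $x_t$ of the Frank-Wolfe algorithm with step-size $\eta_t$, with $h_t=f(x_t)-f(x^* )$, it holds that $$h_t\le\eta_{t-2}^2\max\left\{\frac{h_S}{\eta_{S-1}^2},\ \frac{B^2}{A^2}+B,\ \frac{D}{\eta_S^2}+E\right\}$$ for all $t\in\{S,\ldots,T\}$, where $$A=\frac{\sqrt{\alpha_f}\,\beta}{2\sqrt2},\qquad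 B=\frac{L\delta^2}{2}+\frac{\beta\sqrt{\alpha_f\beta M}}{\eta_S2\sqrt2}+\frac{L\beta^2}{\eta_S2},\qquad D=\beta M,\qquad E=\frac{L\delta^2}{2}.$$
   Context: Frank-Wolfe algorithm (FW): given $x_0\in\mathcal{C}$ and step-sizes $\eta_t\in[0,1]$ for $t\in\{0,\ldots,T-1\}$, for $t=0,\ldots,T-1$ choose $p_t\in\operatorname{argmin}_{p\in\mathcal{C}}\langle\nabla f(x_t),p-x_t\rangle$ and set $x_{t+1}=(1-\eta_t)x_t+\eta_tp_t$. $L$-smooth ($L>0$): $f$ is differentiable in an open set containing $\mathcal{C}$ and $f(y)\le f(x)+\langle\nabla f(x),y-x\rangle+\frac{L}{2}\|x-y\|_2^2$ for all $x,y\in\mathcal{C}$. $\alpha_f$-strongly convex ($\alpha_f>0$): $f(y)\ge f(x)+\langle\nabla f(x),y-x\rangle+\frac{\alpha_f}{2}\|x-y\|_2^2$ for all $x,y\in\mathcal{C}$. $\operatorname{vert}(\cdot)$ is the set of vertices, $\operatorname{aff}(\cdot)$ the affine hull, and $B_\beta(z)=\{x\in\mathbb{R}^d\mid\|x-z\|_2\le\beta\}$. The diameter is with respect to $\|\cdot\|_2$. *)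

theory Defs
  imports "HOL-Analysis.Analysis"
begin

definition grad :: "('a::euclidean_space \<Rightarrow> real) \<Rightarrow> 'a \<Rightarrow> 'a" where
  "grad f x = (THE D. GDERIV f x :> D)"

(* The definite description above is well defined wherever f is differentiable. *)
lemma GDERIV_grad:
  fixes f :: "'a::euclidean_space \<Rightarrow> real"
  assumes "f differentiable (at x)"
  shows "GDERIV f x :> grad f x"
proof -
  obtain f' where f': "(f has_derivative f') (at x)"
    using assms by (auto simp: differentiable_def)
  then interpret bounded_linear f'
    by (rule has_derivative_bounded_linear)
  define D where "D = (\<Sum>b\<in>Basis. f' b *\<^sub>R b)"
  have "f' h = h \<bullet> D" for h
  proof -
    have "f' h = f' (\<Sum>b\<in>Basis. (h \<bullet> b) *\<^sub>R b)"
      by (simp add: euclidean_representation)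
    also have "\<dots> = h \<bullet> D"
      by (simp add: sum scaleR D_def inner_sum_right mult.commute)
    finally show ?thesis .
  qed
  then have "f' = (\<lambda>h. h \<bullet> D)"
    by (rule ext)
  with f' have D: "GDERIV f x :> D"
    by (simp add: gderiv_def)
  have "E = D" if "GDERIV f x :> E" for E
  proof -
    have "(\<lambda>h. h \<bullet> E) = (\<lambda>h. h \<bullet> D)"
      using that D unfolding gderiv_def by (rule has_derivative_unique)
    then have "h \<bullet> E = h \<bullet> D" for h
      by meson
    then show ?thesis
      using vector_eq_ldot by blast
  qed
  with D show ?thesis
    unfolding grad_def by (rule theI)
qed

definition smooth_over :: "'a::euclidean_space set \<Rightarrow> real \<Rightarrow> ('a \<Rightarrow> real) \<Rightarrow> bool" where
  "smooth_over C L f \<longleftrightarrow>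
     (\<exists>U. open U \<and> C \<subseteq> U \<and> f differentiable_on U) \<and>
     (\<forall>x\<in>C. \<forall>y\<in>C. f y \<le> f x + grad f x \<bullet> (y - x) + L / 2 * (norm (x - y))\<^sup>2)"

definition strongly_convex_over :: "'a::euclidean_space set \<Rightarrow> real \<Rightarrow> ('a \<Rightarrow> real) \<Rightarrow> bool" where
  "strongly_convex_over C \<alpha> f \<longleftrightarrow>
     (\<forall>x\<in>C. \<forall>y\<in>C. f y \<ge> f x + grad f x \<bullet> (y - x) + \<alpha> / 2 * (norm (x - y))\<^sup>2)"

(* Vertices are the zero-dimensional faces; see face_of_singleton. *)
definition vert :: "'a::euclidean_space set \<Rightarrow> 'a set" where
  "vert P = {v. v extreme_point_of P}"

(* Only x 0, ..., x T are constrained.  The minimizer p is an arbitrary one at each step,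
   as it need not be unique. *)
definition frank_wolfe ::
  "'a::euclidean_space set \<Rightarrow> ('a \<Rightarrow> real) \<Rightarrow> (nat \<Rightarrow> real) \<Rightarrow> nat \<Rightarrow> (nat \<Rightarrow> 'a) \<Rightarrow> bool" where
  "frank_wolfe C f \<eta> T x \<longleftrightarrow>
     x 0 \<in> C \<and>
     (\<forall>t<T. \<eta> t \<in> {0..1} \<and>
       (\<exists>p. is_arg_min (\<lambda>p. grad f (x t) \<bullet> (p - x t)) (\<lambda>p. p \<in> C) p \<and>
            x (Suc t) = (1 - \<eta> t) *\<^sub>R x t + \<eta> t *\<^sub>R p))"

end

(* Let d_t be the distance from x_t to the affine hull of the optimal face. The standard O(1/t)
   rate puts x_t within distance beta of the minimizer for t >= S, and forces every Frank-Wolfe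
   vertex from then on into the optimal face, so that d_t decays like eta_t^2.
   Let a be the component of the gradient g at x_t parallel to that face.
   The ball of radius beta in the face makes the Frank-Wolfe gap at least h_t + beta |a|,
   and strong convexity gives h_t <= |a|^2 / (2 alpha) + M d_t.
   Together these give h_(t+1) <= (1 - eta_t / 2) h_t - eta_t A sqrt h_t + eta_t^2 B,
   a recursion whose solutions decay like eta_t^2. *)
theory Submission
  imports Defs
begin

lemma strong_convexity_le_smoothness:
  assumes "strongly_convex_over C \<alpha> f" and "smooth_over C L f"
    and "x \<in> C" and "y \<in> C" and "x \<noteq> y"
  shows "\<alpha> \<le> L"
proof -
  have "f x + grad f x \<bullet> (y - x) + \<alpha> / 2 * (norm (x - y))\<^sup>2 \<le> f y"
    using assms by (simp add: strongly_convex_over_def)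
  also have "f y \<le> f x + grad f x \<bullet> (y - x) + L / 2 * (norm (x - y))\<^sup>2"
    using assms by (simp add: smooth_over_def)
  finally have "\<alpha> / 2 * (norm (x - y))\<^sup>2 \<le> L / 2 * (norm (x - y))\<^sup>2"
    by simp
  with \<open>x \<noteq> y\<close> show ?thesis
    by simp
qed

text \<open>The displacement from \<open>x\<close> is \<open>s\<close> times a chord of
  \<open>C\<close>, hence at most \<open>s\<close> times the diameter. This yields both the
  Frank-Wolfe descent step and the upper bound in the segment argument below.\<close>

lemma smooth_segment_bound:
  assumes "smooth_over C L f" and "L \<ge> 0" and "convex C" and "bounded C"
    and "x \<in> C" and "p \<in> C" and "0 \<le> s" and "s \<le> 1"
  shows "f ((1 - s) *\<^sub>R x + s *\<^sub>R p)
    \<le> f x + s * (grad f x \<bullet> (p - x)) + s\<^sup>2 * (L * (diameter C)\<^sup>2 / 2)"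
proof -
  let ?y = "(1 - s) *\<^sub>R x + s *\<^sub>R p"
  have "?y \<in> C"
    using assms by (simp add: convexD_alt)
  then have 1: "f ?y \<le> f x + grad f x \<bullet> (?y - x) + L / 2 * (norm (x - ?y))\<^sup>2"
    using assms by (simp add: smooth_over_def)
  have y: "?y - x = s *\<^sub>R (p - x)"
    by (simp add: algebra_simps)
  have "norm (x - ?y) = s * norm (p - x)"
    using y \<open>0 \<le> s\<close> by (metis abs_of_nonneg norm_minus_commute norm_scaleR)
  moreover have "norm (p - x) \<le> diameter C"
    using diameter_bounded_bound[OF \<open>bounded C\<close> \<open>p \<in> C\<close> \<open>x \<in> C\<close>] by (simp add: dist_norm)
  ultimately have "(norm (x - ?y))\<^sup>2 \<le> s\<^sup>2 * (diameter C)\<^sup>2"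
    by (simp add: power_mult_distrib mult_left_mono power_mono)
  then have "L / 2 * (norm (x - ?y))\<^sup>2 \<le> L / 2 * (s\<^sup>2 * (diameter C)\<^sup>2)"
    using \<open>L \<ge> 0\<close> by (intro mult_left_mono) auto
  with 1 show ?thesis
    unfolding y by (simp add: algebra_simps)
qed

lemma strongly_convex_gap:
  assumes "strongly_convex_over C \<alpha> f" and "x \<in> C" and "y \<in> C"
  shows "f x - f y \<le> grad f x \<bullet> (x - y) - \<alpha> / 2 * (norm (x - y))\<^sup>2"
proof -
  have "f x + grad f x \<bullet> (y - x) + \<alpha> / 2 * (norm (x - y))\<^sup>2 \<le> f y"
    using assms by (simp add: strongly_convex_over_def)
  then show ?thesis
    by (simp add: inner_diff_right)
qed

text \<open>Inserting the bound for \<open>n\<close> into the recursion leaves the factor n/(n+3) +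
  1/(n+4), which is at most 1.\<close>

lemma open_loop_rate:
  fixes h :: "nat \<Rightarrow> real"
  assumes step: "\<And>t. t < T \<Longrightarrow> h (Suc t) \<le> (1 - 4 / (real t + 4)) * h t + (4 / (real t + 4))\<^sup>2 * E"
    and "E \<ge> 0" and "1 \<le> t" and "t \<le> T"
  shows "h t \<le> 16 * E / (real t + 3)"
  using \<open>1 \<le> t\<close> \<open>t \<le> T\<close>
proof (induction t rule: dec_induct)
  \<comment> \<open>At index 0 the step-size is 1, so the coefficient of \<open>h 0\<close> vanishes
    and \<open>h 1 \<le> E\<close> whatever \<open>h 0\<close> is.\<close>
  case base
  then show ?case
    using step[of 0] \<open>E \<ge> 0\<close> by simp
next
  case (step n)
  have "h (Suc n) \<le> (1 - 4 / (real n + 4)) * h n + (4 / (real n + 4))\<^sup>2 * E"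
    using assms(1) step.prems by simp
  also have "\<dots> \<le> (1 - 4 / (real n + 4)) * (16 * E / (real n + 3)) + (4 / (real n + 4))\<^sup>2 * E"
    using step by (intro add_right_mono mult_left_mono) (auto simp: field_simps)
  also have "\<dots> = 16 * E / (real n + 4) * (n / (real n + 3) + 1 / (real n + 4))"
    by (simp add: divide_simps power2_eq_square) (simp add: algebra_simps)
  also have "\<dots> \<le> 16 * E / (real n + 4) * 1"
  proof (intro mult_left_mono)
    have "n / (real n + 3) + 1 / (real n + 4) \<le> n / (real n + 3) + 1 / (real n + 3)"
      by (simp add: frac_le)
    also have "\<dots> \<le> 1"
      by (simp add: field_simps)
    finally show "n / (real n + 3) + 1 / (real n + 4) \<le> 1" .
  qed (use \<open>E \<ge> 0\<close> in simp)
  finally show ?case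
    by (simp add: add.commute)
qed

text \<open>With e = 4/(t+4): below the threshold e^2 B^2/A^2 the value is already of order e^2;
  above it the square-root term absorbs e^2 B and the contraction 1 - e/2 remains. The invariant is
  a product of consecutive step-sizes because 1 - e/2 = (t+2)/(t+4) carries it exactly to its
  successor.\<close>

lemma open_loop_accelerated_rate:
  fixes h \<eta> :: "nat \<Rightarrow> real"
  assumes step: "\<And>t. S \<le> t \<Longrightarrow> t < T \<Longrightarrow>
      h (Suc t) \<le> (1 - 2 / (real t + 4)) * h t - 4 / (real t + 4) * A * sqrt (h t) + (4 / (real t + 4))\<^sup>2 * B"
    and nonneg: "\<And>t. t \<le> T \<Longrightarrow> 0 \<le> h t"
    and "A > 0" and "B \<ge> 0" and K: "B\<^sup>2 / A\<^sup>2 + B \<le> K" and "h S \<le> 4 / (real S + 2) * (4 / (real S + 3)) * K"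
    and "S \<le> t" and "t \<le> T"
  shows "h t \<le> 4 / (real t + 2) * (4 / (real t + 3)) * K"
  using \<open>S \<le> t\<close> \<open>t \<le> T\<close>
proof (induction t rule: dec_induct)
  case base
  then show ?case
    using assms by simp
next
  case (step t)
  define e where "e = 4 / (real t + 4)"
  have e: "0 < e" "e \<le> 1"
    by (simp_all add: e_def)
  have e2: "e / 2 = 2 / (real t + 4)"
    unfolding e_def by (simp add: divide_simps)
  have "0 \<le> B\<^sup>2 / A\<^sup>2"
    by simp
  then have "0 \<le> K"
    using K \<open>B \<ge> 0\<close> by linarith
  have rec: "h (Suc t) \<le> (1 - e / 2) * h t - e * A * sqrt (h t) + e\<^sup>2 * B"
    unfolding e2 unfolding e_def using assms(1)[of t] step by simp
  have "h (Suc t) \<le> 4 / (real t + 3) * e * K"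
  proof (cases "h t \<le> e\<^sup>2 * (B\<^sup>2 / A\<^sup>2)")
    case True
    have "(1 - e / 2) * h t \<le> h t"
      using e nonneg[of t] step by (simp add: algebra_simps)
    moreover have "0 \<le> e * A * sqrt (h t)"
      using e \<open>A > 0\<close> nonneg[of t] step by simp
    ultimately have "h (Suc t) \<le> e\<^sup>2 * (B\<^sup>2 / A\<^sup>2) + e\<^sup>2 * B"
      using rec True by linarith
    also have "\<dots> = e * (B\<^sup>2 / A\<^sup>2 + B) * e"
      by (simp add: algebra_simps power2_eq_square)
    \<comment> \<open>One factor \<open>e\<close> is enlarged to 4/(t+3) to reach the product
      form.\<close>
    also have "\<dots> \<le> e * K * (4 / (real t + 3))"
      using e K \<open>0 \<le> K\<close> \<open>B \<ge> 0\<close> by (intro mult_mono) (auto simp: e_def frac_le)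
    finally show ?thesis
      by (simp add: mult_ac)
  next
    case False
    then have "(e * B / A)\<^sup>2 \<le> h t"
      by (simp add: power_divide power_mult_distrib)
    then have "e * B / A \<le> sqrt (h t)"
      by (rule real_le_rsqrt)
    then have "e * B \<le> A * sqrt (h t)"
      using \<open>A > 0\<close> by (simp add: field_simps)
    then have "e * (e * B) \<le> e * (A * sqrt (h t))"
      using e by (intro mult_left_mono) auto
    then have "h (Suc t) \<le> (1 - e / 2) * h t"
      using rec by (simp add: power2_eq_square mult_ac)
    also have "\<dots> \<le> (1 - e / 2) * (4 / (real t + 2) * (4 / (real t + 3)) * K)"
      using e step by (intro mult_left_mono) (auto simp: add.commute)
    also have "\<dots> = ((1 - e / 2) * (4 / (real t + 2))) * (4 / (real t + 3)) * K"
      by simp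
    also have "(1 - e / 2) * (4 / (real t + 2)) = e"
      by (simp add: e_def divide_simps) (simp add: algebra_simps)
    finally show ?thesis
      by (simp add: mult_ac)
  qed
  then show ?case
    by (simp add: e_def mult_ac add.commute)
qed

text \<open>The minimizers of a linear functional form a face, which is the convex hull of its own
  vertices, and these are vertices of \<open>C\<close>. Knowledge about vertices thus controls an
  arbitrary minimizer.\<close>

lemma linear_minimizer_in_convex:
  assumes "polytope C" and "convex G" and "p \<in> C" and min: "\<And>q. q \<in> C \<Longrightarrow> g \<bullet> p \<le> g \<bullet> q"
    and vert: "\<And>v. v \<in> vert C \<Longrightarrow> g \<bullet> v = g \<bullet> p \<Longrightarrow> v \<in> G"
  shows "p \<in> G"
proof -
  let ?F = "C \<inter> {y. g \<bullet> y = g \<bullet> p}"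
  have F: "?F face_of C"
    using face_of_Int_supporting_hyperplane_ge[OF polytope_imp_convex[OF \<open>polytope C\<close>]] min by blast
  have "?F = convex hull {v. v extreme_point_of ?F}"
    using face_of_polytope_polytope[OF \<open>polytope C\<close> F]
    by (simp add: Krein_Milman_Minkowski polytope_imp_compact polytope_imp_convex)
  moreover have "{v. v extreme_point_of ?F} \<subseteq> G"
    using vert extreme_point_of_face[OF F] by (auto simp: vert_def)
  ultimately have "?F \<subseteq> G"
    using \<open>convex G\<close> by (metis (lifting) hull_minimal)
  with \<open>p \<in> C\<close> show ?thesis
    by blast
qed

text \<open>A polytope is the convex hull of its vertices. With \<open>g\<close> the gradient at the
  minimizer, this turns hypothesis (a) on vertices into first-order optimality over
  \<open>C\<close>.\<close>

lemma polytope_inner_nonneg: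
  assumes "polytope C" and "\<And>v. v \<in> vert C \<Longrightarrow> g \<bullet> (v - z) \<ge> 0" and "y \<in> C"
  shows "g \<bullet> (y - z) \<ge> 0"
proof -
  have "C = convex hull (vert C)"
    using \<open>polytope C\<close>
    by (simp add: vert_def Krein_Milman_Minkowski polytope_imp_compact polytope_imp_convex)
  also have "\<dots> \<subseteq> {y. g \<bullet> y \<ge> g \<bullet> z}"
    using assms(2) by (intro hull_minimal) (auto simp: inner_diff_right convex_halfspace_ge)
  finally show ?thesis
    using \<open>y \<in> C\<close> by (auto simp: inner_diff_right)
qed

text \<open>Minimality of \<open>xstar\<close> and the tangent at \<open>xstar\<close> give a lower bound for \<open>f\<close> on the
  segment from \<open>y\<close> to \<open>p\<close>, smoothness at \<open>y\<close> an upper bound. If \<open>p\<close> were a descent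
  direction at \<open>y\<close>, the two would contradict each other at parameter \<open>s = 4 / sqrt S\<close>.\<close>
lemma inner_grad_pos_off_optimal_face:
  assumes sc: "strongly_convex_over C \<alpha> f" and "\<alpha> > 0" and sm: "smooth_over C L f" and "\<alpha> \<le> L"
    and "convex C" and "bounded C" and "diameter C > 0"
    and "xstar \<in> C" and "y \<in> C" and "p \<in> C"
    and opt: "grad f xstar \<bullet> (y - xstar) \<ge> 0" and \<kappa>: "grad f xstar \<bullet> (p - xstar) \<ge> \<kappa>" and "\<kappa> > 0"
    and "S \<ge> 16" and S: "S \<ge> 64 * L ^ 3 * (diameter C) ^ 4 / (\<alpha> * \<kappa>\<^sup>2)"
    and h: "f y - f xstar < 8 * L * (diameter C)\<^sup>2 / S"
  shows "grad f y \<bullet> (p - y) > 0"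
proof (rule ccontr)
  assume neg: "\<not> grad f y \<bullet> (p - y) > 0"
  define d where "d = diameter C"
  \<comment> \<open>With s^2 = 16/S, the assumed bound on the primal gap of \<open>y\<close> equals
    the curvature term s^2 L d^2 / 2; S \<ge> 16 ensures s \<le> 1.\<close>
  define s where "s = 4 / sqrt S"
  have "sqrt 16 \<le> sqrt S"
    using \<open>S \<ge> 16\<close> by (intro real_sqrt_le_mono)
  then have sq: "4 \<le> sqrt S"
    by simp
  then have s: "0 < s" "s \<le> 1"
    using \<open>S \<ge> 16\<close> by (auto simp: s_def)
  have s2: "s\<^sup>2 = 16 / S"
    using \<open>S \<ge> 16\<close> by (simp add: s_def power_divide)
  have "L > 0" "d > 0"
    using assms by (auto simp: d_def)
  have "64 * L ^ 3 * d ^ 4 \<le> S * (\<alpha> * \<kappa>\<^sup>2)"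
    using S \<open>\<alpha> > 0\<close> \<open>\<kappa> > 0\<close> by (simp add: d_def divide_simps)
  \<comment> \<open>Replacing \<alpha> by \<open>L\<close> lets one factor \<open>L\<close> cancel,
    so that both sides become squares.\<close>
  also have "\<dots> \<le> S * (L * \<kappa>\<^sup>2)"
    using \<open>\<alpha> \<le> L\<close> \<open>S \<ge> 16\<close> by (intro mult_left_mono mult_right_mono) auto
  finally have "L * (64 * L\<^sup>2 * d ^ 4) \<le> L * (S * \<kappa>\<^sup>2)"
    by (simp add: power3_eq_cube power2_eq_square mult_ac)
  then have "64 * L\<^sup>2 * d ^ 4 \<le> S * \<kappa>\<^sup>2"
    using \<open>L > 0\<close> by simp
  then have "(8 * L * d\<^sup>2)\<^sup>2 \<le> (sqrt S * \<kappa>)\<^sup>2"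
    using \<open>S \<ge> 16\<close> by (simp add: power_mult_distrib flip: power_mult)
  then have "8 * L * d\<^sup>2 \<le> sqrt S * \<kappa>"
    using \<open>\<kappa> > 0\<close> \<open>S \<ge> 16\<close> by (elim power2_le_imp_le) simp
  then have "8 * L * d\<^sup>2 * s\<^sup>2 \<le> sqrt S * \<kappa> * s\<^sup>2"
    by (rule mult_right_mono) simp
  also have "\<dots> = (sqrt S * s) * s * \<kappa>"
    by (simp add: power2_eq_square mult_ac)
  also have "sqrt S * s = 4"
    using \<open>S \<ge> 16\<close> by (simp add: s_def)
  finally have "2 * L * d\<^sup>2 * s\<^sup>2 \<le> s * \<kappa>"
    by (simp add: mult_ac)
  let ?z = "(1 - s) *\<^sub>R y + s *\<^sub>R p"
  have "?z \<in> C"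
    using assms s by (simp add: convexD_alt)
  then have "f xstar + grad f xstar \<bullet> (?z - xstar) + \<alpha> / 2 * (norm (xstar - ?z))\<^sup>2 \<le> f ?z"
    using sc \<open>xstar \<in> C\<close> by (auto simp: strongly_convex_over_def)
  moreover have "0 \<le> \<alpha> / 2 * (norm (xstar - ?z))\<^sup>2"
    using \<open>\<alpha> > 0\<close> by simp
  moreover have "?z - xstar = (1 - s) *\<^sub>R (y - xstar) + s *\<^sub>R (p - xstar)"
    by (simp add: algebra_simps)
  then have "grad f xstar \<bullet> (?z - xstar)
      = (1 - s) * (grad f xstar \<bullet> (y - xstar)) + s * (grad f xstar \<bullet> (p - xstar))"
    by (simp only: inner_add_right inner_scaleR_right)
  moreover have "0 \<le> (1 - s) * (grad f xstar \<bullet> (y - xstar))"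
    using s opt by simp
  moreover have "s * \<kappa> \<le> s * (grad f xstar \<bullet> (p - xstar))"
    using s \<kappa> by simp
  moreover have "f ?z \<le> f y + s * (grad f y \<bullet> (p - y)) + s\<^sup>2 * (L * d\<^sup>2 / 2)"
    unfolding d_def using assms s \<open>L > 0\<close> by (intro smooth_segment_bound) auto
  moreover have "s * (grad f y \<bullet> (p - y)) \<le> 0"
    using neg s by (simp add: mult_nonneg_nonpos)
  moreover have "f y - f xstar < s\<^sup>2 * (L * d\<^sup>2 / 2)"
    using h by (simp add: s2 d_def)
  moreover have "L * d\<^sup>2 * s\<^sup>2 = 2 * (s\<^sup>2 * (L * d\<^sup>2 / 2))"
    by simp
  \<comment> \<open>Chained: f xstar + s \<kappa> \<le> f z < f xstar + s^2 L d^2, whereas s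
    \<kappa> is at least twice that margin.\<close>
  ultimately have "s * \<kappa> < L * d\<^sup>2 * s\<^sup>2"
    by linarith
  moreover have "0 < L * d\<^sup>2 * s\<^sup>2"
    using \<open>L > 0\<close> \<open>d > 0\<close> s by simp
  ultimately show False
    using \<open>2 * L * d\<^sup>2 * s\<^sup>2 \<le> s * \<kappa>\<close> by linarith
qed

text \<open>This is the gain \<beta> |a| from the ball in the face, with \<open>a\<close> the
  gradient component in \<open>W\<close>, and |a| eliminated in favour of the root of the primal
  gap. The bound on \<open>w\<close> is a square so that the root of its cost M \<beta> r^2 is
  linear in \<open>r\<close>, which later is \<open>e t / e S\<close>.\<close>

lemma gap_lower_bound_near_face:
  fixes W :: "'a::euclidean_space set"
  assumes "strongly_convex_over C \<alpha> f" and "\<alpha> > 0" and "x \<in> C" and "xstar \<in> C"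
    and M: "norm (grad f x) \<le> M"
    and "subspace W" and ball: "\<And>q. q \<in> W \<Longrightarrow> norm q \<le> \<beta> \<Longrightarrow> xstar + q \<in> C" and "\<beta> > 0"
    and min: "\<And>q. q \<in> C \<Longrightarrow> grad f x \<bullet> p \<le> grad f x \<bullet> q"
    and x: "x - xstar = u + w" "u \<in> W" "\<And>v. v \<in> W \<Longrightarrow> orthogonal w v"
    and w: "norm w \<le> \<beta> * r\<^sup>2" "r \<ge> 0"
    and "0 \<le> f x - f xstar"
  shows "(f x - f xstar)
      + sqrt \<alpha> * \<beta> / (2 * sqrt 2) * (sqrt (f x - f xstar) - sqrt (\<beta> * M) * r)
    \<le> grad f x \<bullet> (x - p)"
proof -
  define g where "g = grad f x"
  obtain a b where a: "a \<in> W" and b: "\<And>v. v \<in> W \<Longrightarrow> orthogonal b v" and g: "g = a + b"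
    using orthogonal_subspace_decomp_exists[of W g] \<open>subspace W\<close> by (metis span_eq_iff)
  \<comment> \<open>The minimizer of the linear functional over the \<beta>-ball in
    \<open>W\<close>. If \<open>a\<close> is 0 then so is \<open>q\<close>, hence only an upper
    bound on its norm is claimed.\<close>
  define q where "q = (- \<beta> / norm a) *\<^sub>R a"
  have gap1: "f x - f xstar \<le> g \<bullet> (x - xstar) - \<alpha> / 2 * (norm (x - xstar))\<^sup>2"
    unfolding g_def using assms by (intro strongly_convex_gap)
  have "q \<in> W"
    unfolding q_def using a \<open>subspace W\<close> by (intro subspace_scale)
  moreover have "norm q \<le> \<beta>"
    using \<open>\<beta> > 0\<close> by (simp add: q_def)
  ultimately have "g \<bullet> p \<le> g \<bullet> (xstar + q)"
    unfolding g_def by (intro min ball)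
  moreover have "b \<bullet> a = 0"
    using b[OF a] by (simp add: orthogonal_def)
  then have "g \<bullet> q = - \<beta> * norm a"
    by (cases "a = 0") (auto simp: g q_def inner_add_left dot_square_norm power2_eq_square)
  ultimately have gap2: "g \<bullet> (x - xstar) + \<beta> * norm a \<le> g \<bullet> (x - p)"
    by (simp add: inner_diff_right inner_add_right)
  have "0 \<le> M"
    using M norm_ge_zero order_trans by blast
  have "u \<bullet> w = 0" "b \<bullet> u = 0"
    using x(3)[OF x(2)] b[OF x(2)] by (auto simp: orthogonal_def inner_commute)
  then have "(norm (x - xstar))\<^sup>2 = (norm u)\<^sup>2 + (norm w)\<^sup>2"
    unfolding x by (intro norm_add_Pythagorean) (simp add: orthogonal_def)
  then have "\<alpha> / 2 * (norm u)\<^sup>2 \<le> \<alpha> / 2 * (norm (x - xstar))\<^sup>2"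
    using \<open>\<alpha> > 0\<close> by (intro mult_left_mono) auto
  moreover have "g \<bullet> w \<le> M * (\<beta> * r\<^sup>2)"
  proof -
    have "g \<bullet> w \<le> norm g * norm w"
      by (rule norm_cauchy_schwarz)
    also have "\<dots> \<le> M * (\<beta> * r\<^sup>2)"
      using M w \<open>0 \<le> M\<close> by (intro mult_mono) (auto simp: g_def)
    finally show ?thesis .
  qed
  moreover have "g \<bullet> (x - xstar) = a \<bullet> u + g \<bullet> w"
    using \<open>b \<bullet> u = 0\<close> by (simp add: x inner_add_right) (simp add: g inner_add_left)
  moreover have "a \<bullet> u \<le> norm a * norm u"
    by (rule norm_cauchy_schwarz)
  \<comment> \<open>Young's inequality, weighted so that \<alpha>/2 |u|^2 cancels against the strong
    convexity term in \<open>gap1\<close>.\<close>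
  moreover have "norm a * norm u \<le> (norm a)\<^sup>2 / (2 * \<alpha>) + \<alpha> / 2 * (norm u)\<^sup>2"
  proof -
    have "0 \<le> (norm a - \<alpha> * norm u)\<^sup>2 / (2 * \<alpha>)"
      using \<open>\<alpha> > 0\<close> by simp
    also have "\<dots> = (norm a)\<^sup>2 / (2 * \<alpha>) + \<alpha> / 2 * (norm u)\<^sup>2 - norm a * norm u"
      using \<open>\<alpha> > 0\<close> by (simp add: field_simps power2_eq_square)
    finally show ?thesis
      by simp
  qed
  ultimately have "f x - f xstar \<le> (norm a)\<^sup>2 / (2 * \<alpha>) + M * (\<beta> * r\<^sup>2)"
    using gap1 by linarith
  also have "\<dots> = (norm a / sqrt (2 * \<alpha>))\<^sup>2 + (sqrt (\<beta> * M) * r)\<^sup>2"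
    using \<open>\<alpha> > 0\<close> \<open>0 \<le> M\<close> \<open>\<beta> > 0\<close> by (simp add: power_divide power_mult_distrib)
  \<comment> \<open>Completing the square prepares taking roots on both sides.\<close>
  also have "\<dots> \<le> (norm a / sqrt (2 * \<alpha>) + sqrt (\<beta> * M) * r)\<^sup>2"
    using \<open>\<alpha> > 0\<close> \<open>0 \<le> M\<close> \<open>\<beta> > 0\<close> w by (simp add: power2_sum)
  finally have "sqrt (f x - f xstar) \<le> norm a / sqrt (2 * \<alpha>) + sqrt (\<beta> * M) * r"
    using \<open>\<alpha> > 0\<close> \<open>0 \<le> M\<close> \<open>\<beta> > 0\<close> w by (intro real_le_lsqrt) auto
  then have "sqrt \<alpha> * \<beta> / (2 * sqrt 2) * (sqrt (f x - f xstar) - sqrt (\<beta> * M) * r)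
      \<le> sqrt \<alpha> * \<beta> / (2 * sqrt 2) * (norm a / sqrt (2 * \<alpha>))"
    using \<open>\<alpha> > 0\<close> \<open>\<beta> > 0\<close> by (intro mult_left_mono) auto
  \<comment> \<open>The given constant spends a quarter of the gain \<beta> |a|.\<close>
  also have "\<dots> = \<beta> * norm a / 4"
    using \<open>\<alpha> > 0\<close> by (simp add: real_sqrt_mult field_simps)
  also have "\<dots> \<le> \<beta> * norm a"
    using \<open>\<beta> > 0\<close> by simp
  finally show ?thesis
    using gap1 gap2 \<open>\<alpha> > 0\<close> unfolding g_def by (smt (verit) divide_nonneg_nonneg mult_nonneg_nonneg zero_le_power2)
qed

text \<open>The distance to the affine hull of the optimal face shrinks by the factor 1 - 4/(t+4)
  per step; this keeps it below a multiple of the squared step-size. Clearing denominators leaves t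
  (t+5)^2 \<le> (t+4)^3.\<close>

lemma open_loop_contraction:
  fixes t :: nat
  shows "(1 - 4 / (real t + 4)) * (4 / (real t + 4) / c)\<^sup>2 \<le> (4 / (real (Suc t) + 4) / c)\<^sup>2"
proof -
  have "real t * (real t + 5)\<^sup>2 \<le> (real t + 4) ^ 3"
    by (simp add: power2_eq_square power3_eq_cube algebra_simps)
  then have "real t / (real t + 4) ^ 3 \<le> 1 / (real t + 5)\<^sup>2"
    by (simp add: divide_simps mult.commute)
  then have "real t / (real t + 4) ^ 3 * (16 / c\<^sup>2) \<le> 1 / (real t + 5)\<^sup>2 * (16 / c\<^sup>2)"
    by (intro mult_right_mono) auto
  moreover have "1 - 4 / (real t + 4) = real t / (real t + 4)"
    by (simp add: divide_simps)
  ultimately show ?thesis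
    by (simp add: power_divide power3_eq_cube power2_eq_square mult_ac add.commute)
qed

theorem theorem4p5:
  fixes C Cstar :: "(real ^ 'd) set"
    and f :: "real ^ 'd \<Rightarrow> real"
    and xstar :: "real ^ 'd"
    and x :: "nat \<Rightarrow> real ^ 'd"
    and \<eta> :: "int \<Rightarrow> real"
    and h :: "nat \<Rightarrow> real"
    and \<delta> \<alpha>\<^sub>f L \<beta> \<kappa> M A B D E :: real
    and S T :: nat
  assumes "polytope C"
    and "\<delta> = diameter C" and "\<delta> > 0"
    and "\<alpha>\<^sub>f > 0" and "strongly_convex_over C \<alpha>\<^sub>f f"
    and "L > 0" and "smooth_over C L f"
    and "is_arg_min f (\<lambda>y. y \<in> C) xstar"
    and "\<forall>y. is_arg_min f (\<lambda>y. y \<in> C) y \<longrightarrow> y = xstar"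
    and "Cstar face_of C" and "aff_dim Cstar \<ge> 1"
    and "xstar \<in> rel_interior Cstar"
    and "\<beta> > 0" and "\<kappa> > 0"
    and "\<forall>p \<in> vert C - Cstar. grad f xstar \<bullet> (p - xstar) \<ge> \<kappa>"
    and "\<forall>p \<in> vert Cstar. grad f xstar \<bullet> (p - xstar) = 0"
    and "cball xstar \<beta> \<inter> affine hull Cstar \<noteq> {}"
    and "cball xstar \<beta> \<inter> affine hull Cstar \<subseteq> C"
    and "M \<in> (\<lambda>y. norm (grad f y)) ` C" and "\<forall>y\<in>C. norm (grad f y) \<le> M"
    and "int S = max \<lceil>16 * L * \<delta>\<^sup>2 / (\<alpha>\<^sub>f * \<beta>\<^sup>2)\<rceil> \<lceil>64 * L ^ 3 * \<delta> ^ 4 / (\<alpha>\<^sub>f * \<kappa>\<^sup>2)\<rceil>"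
    and "\<forall>t. \<eta> t = 4 / (of_int t + 4)"
    and "frank_wolfe C f (\<lambda>t. \<eta> (int t)) T x"
    and "\<forall>t. h t = f (x t) - f xstar"
    and "A = sqrt \<alpha>\<^sub>f * \<beta> / (2 * sqrt 2)"
    and "B = L * \<delta>\<^sup>2 / 2 + \<beta> * sqrt (\<alpha>\<^sub>f * \<beta> * M) / (\<eta> (int S) * 2 * sqrt 2)
             + L * \<beta>\<^sup>2 / (\<eta> (int S) * 2)"
    and "D = \<beta> * M"
    and "E = L * \<delta>\<^sup>2 / 2"
  shows "\<forall>t \<in> {S..T}. h t \<le> (\<eta> (int t - 2))\<^sup>2 *
           Max {h S / (\<eta> (int S - 1))\<^sup>2, B\<^sup>2 / A\<^sup>2 + B, D / (\<eta> (int S))\<^sup>2 + E}"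
proof -

  \<comment> \<open>Step-sizes, convexity and the optimal face\<close>
  define e where "e t = 4 / (real t + 4)" for t :: nat
  have e: "0 < e t" "e t \<le> 1" for t
    by (simp_all add: e_def)
  have \<eta>: "\<eta> (int t) = e t" for t
    using assms(22) by (simp add: e_def)
  have cvx: "convex C" and bdd: "bounded C"
    using assms(1) by (auto simp: polytope_imp_convex polytope_imp_bounded)
  note sc = assms(5) and sm = assms(7) and \<alpha> = \<open>\<alpha>\<^sub>f > 0\<close> and L = \<open>L > 0\<close>
  have xs: "xstar \<in> C" "\<And>y. y \<in> C \<Longrightarrow> f xstar \<le> f y"
    using assms(8) by (auto simp: is_arg_min_def not_less)
  have xsF: "xstar \<in> Cstar"
    using assms(12) rel_interior_subset by blast
  have FC: "Cstar \<subseteq> C"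
    using assms(10) by (rule face_of_imp_subset)
  have cvxF: "convex Cstar"
    using assms(10) by (rule face_of_imp_convex)

  \<comment> \<open>Feasibility, gap estimates and one-step progress\<close>
  have fw: "\<exists>p\<in>C. (\<forall>q\<in>C. grad f (x t) \<bullet> p \<le> grad f (x t) \<bullet> q)
      \<and> x (Suc t) = (1 - e t) *\<^sub>R x t + e t *\<^sub>R p" if "t < T" for t
  proof -
    obtain p where "is_arg_min (\<lambda>p. grad f (x t) \<bullet> (p - x t)) (\<lambda>p. p \<in> C) p"
      and "x (Suc t) = (1 - e t) *\<^sub>R x t + e t *\<^sub>R p"
      using assms(23) \<open>t < T\<close> unfolding frank_wolfe_def \<eta> by blast
    then show ?thesis
      by (intro bexI[of _ p]) (auto simp: is_arg_min_def not_less inner_diff_right)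
  qed
  have xC: "x t \<in> C" if "t \<le> T" for t
    using that
  proof (induction t)
    case 0
    then show ?case
      using assms(23) by (simp add: frank_wolfe_def)
  next
    case (Suc t)
    then obtain p where "p \<in> C" "x (Suc t) = (1 - e t) *\<^sub>R x t + e t *\<^sub>R p"
      using fw[of t] by auto
    with Suc e[of t] cvx show ?case
      by (simp add: convexD_alt)
  qed
  have h: "h t = f (x t) - f xstar" for t
    using assms(24) by blast
  have h0: "0 \<le> h t" if "t \<le> T" for t
    using xs(2)[OF xC[OF that]] by (simp add: h)
  have gap: "h t \<le> grad f (x t) \<bullet> (x t - xstar) - \<alpha>\<^sub>f / 2 * (norm (x t - xstar))\<^sup>2" if "t \<le> T" for t
    unfolding h using sc xC[OF that] xs(1) by (rule strongly_convex_gap)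
  have gap': "h t \<le> grad f (x t) \<bullet> (x t - xstar)" if "t \<le> T" for t
    using gap[OF that] \<alpha> by (smt (verit) divide_nonneg_nonneg mult_nonneg_nonneg zero_le_power2)
  have progress: "h (Suc t) \<le> h t - e t * (grad f (x t) \<bullet> (x t - p)) + (e t)\<^sup>2 * E"
    if "t < T" "p \<in> C" "x (Suc t) = (1 - e t) *\<^sub>R x t + e t *\<^sub>R p" for t p
  proof -
    have "f (x (Suc t)) \<le> f (x t) + e t * (grad f (x t) \<bullet> (p - x t)) + (e t)\<^sup>2 * E"
      unfolding that(3) assms(2,28)
      using sm L cvx bdd xC that e[of t] by (intro smooth_segment_bound) auto
    then show ?thesis
      by (simp add: h inner_diff_right right_diff_distrib)
  qed

  \<comment> \<open>Global O(1/t) rate\<close>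
  have E: "0 \<le> E"
    unfolding assms(28) using L by simp
  have rate: "h t \<le> 8 * L * \<delta>\<^sup>2 / (real t + 3)" if "1 \<le> t" "t \<le> T" for t
  proof -
    have "h (Suc t) \<le> (1 - 4 / (real t + 4)) * h t + (4 / (real t + 4))\<^sup>2 * E" if t: "t < T" for t :: nat
    proof -
      obtain p where p: "p \<in> C" "\<forall>q\<in>C. grad f (x t) \<bullet> p \<le> grad f (x t) \<bullet> q"
        "x (Suc t) = (1 - e t) *\<^sub>R x t + e t *\<^sub>R p"
        using fw[OF t] by blast
      \<comment> \<open>The linear minimizer does at least as well as \<open>xstar\<close>, so the
        Frank-Wolfe gap dominates the primal gap.\<close>
      have "h t \<le> grad f (x t) \<bullet> (x t - p)"
        using gap'[of t] p(2) xs(1) t by (force simp: inner_diff_right)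
      then have "e t * h t \<le> e t * (grad f (x t) \<bullet> (x t - p))"
        using e[of t] by (intro mult_left_mono) auto
      with progress[OF t p(1,3)] show ?thesis
        by (simp add: e_def algebra_simps)
    qed
    from open_loop_rate[OF this E that] show ?thesis
      by (simp add: assms(28))
  qed

  \<comment> \<open>Face directions and the size of \<open>S\<close>\<close>
  obtain y where y: "y \<in> Cstar" "y \<noteq> xstar"
  proof -
    \<comment> \<open>A singleton has affine dimension 0. The second point yields both
      \<open>\<alpha>\<^sub>f \<le> L\<close> and \<beta> \<le> \<delta>.\<close>
    have "Cstar \<noteq> {xstar}"
      using \<open>aff_dim Cstar \<ge> 1\<close> by auto
    with xsF that show ?thesis
      by blast
  qed
  have \<alpha>L: "\<alpha>\<^sub>f \<le> L"
    using strong_convexity_le_smoothness[OF sc sm xs(1), of y] y FC by blast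
  \<comment> \<open>The direction space of the face: its affine hull moved so that
    \<open>xstar\<close> becomes the origin.\<close>
  define W where "W = (\<lambda>y. - xstar + y) ` (affine hull Cstar)"
  have W: "subspace W"
    unfolding W_def using xsF by (intro affine_diffs_subspace) (auto simp: hull_inc)
  have WF: "z - xstar \<in> W" if "z \<in> Cstar" for z
    using that by (auto simp: W_def hull_inc intro!: image_eqI[of _ _ z])
  have ball: "xstar + q \<in> C" if "q \<in> W" "norm q \<le> \<beta>" for q
  proof -
    have "xstar + q \<in> affine hull Cstar"
      using that by (auto simp: W_def)
    moreover have "xstar + q \<in> cball xstar \<beta>"
      using that by (simp add: dist_norm)
    ultimately show ?thesis
      using assms(18) by blast
  qed
  have \<beta>\<delta>: "\<beta> \<le> \<delta>"
  proof -
    define q where "q = (\<beta> / norm (y - xstar)) *\<^sub>R (y - xstar)"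
    have nq: "norm q = \<beta>"
      using y \<open>\<beta> > 0\<close> by (simp add: q_def)
    have "q \<in> W"
      using WF[OF y(1)] W by (simp add: q_def subspace_scale)
    then have "xstar + q \<in> C"
      using nq by (intro ball) auto
    from diameter_bounded_bound[OF bdd this xs(1)] show ?thesis
      using nq assms(2) by (simp add: dist_norm)
  qed
  have "real_of_int (int S) \<ge> 16 * L * \<delta>\<^sup>2 / (\<alpha>\<^sub>f * \<beta>\<^sup>2)"
    and "real_of_int (int S) \<ge> 64 * L ^ 3 * \<delta> ^ 4 / (\<alpha>\<^sub>f * \<kappa>\<^sup>2)"
    unfolding assms(21) by linarith+
  then have S1: "S \<ge> 16 * L * \<delta>\<^sup>2 / (\<alpha>\<^sub>f * \<beta>\<^sup>2)" and S2: "S \<ge> 64 * L ^ 3 * \<delta> ^ 4 / (\<alpha>\<^sub>f * \<kappa>\<^sup>2)"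
    by simp_all
  \<comment> \<open>The two comparisons give S \<ge> 16, which the segment argument requires and
    which makes the global rate available from \<open>S\<close> on.\<close>
  have "\<alpha>\<^sub>f * \<beta>\<^sup>2 \<le> L * \<delta>\<^sup>2"
    using \<alpha>L \<beta>\<delta> L \<open>\<beta> > 0\<close> by (intro mult_mono power_mono) auto
  then have "16 \<le> 16 * L * \<delta>\<^sup>2 / (\<alpha>\<^sub>f * \<beta>\<^sup>2)"
    using \<alpha> \<open>\<beta> > 0\<close> by (simp add: field_simps)
  with S1 have S16: "16 \<le> real S"
    by linarith

  \<comment> \<open>Confinement of Frank-Wolfe vertices to the optimal face\<close>
  have hS: "h t < 8 * L * \<delta>\<^sup>2 / S" if "S \<le> t" "t \<le> T" for t
  proof -
    have "h t \<le> 8 * L * \<delta>\<^sup>2 / (real t + 3)"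
      using rate that S16 by simp
    also have "\<dots> < 8 * L * \<delta>\<^sup>2 / S"
      using that S16 L \<open>\<delta> > 0\<close> by (intro divide_strict_left_mono) auto
    finally show ?thesis .
  qed

  have opt_vert: "grad f xstar \<bullet> (v - xstar) \<ge> 0" if "v \<in> vert C" for v
  proof (cases "v \<in> Cstar")
    case True
    with that assms(10,16) show ?thesis
      by (force simp: vert_def extreme_point_of_face)
  next
    case False
    with that assms(15) have "\<kappa> \<le> grad f xstar \<bullet> (v - xstar)"
      by blast
    with \<open>\<kappa> > 0\<close> show ?thesis
      by linarith
  qed
  have minF: "p \<in> Cstar"
    if "S \<le> t" "t \<le> T" "p \<in> C" and min: "\<forall>q\<in>C. grad f (x t) \<bullet> p \<le> grad f (x t) \<bullet> q" for t p
    using assms(1) cvxF \<open>p \<in> C\<close>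
  proof (rule linear_minimizer_in_convex)
    show "grad f (x t) \<bullet> p \<le> grad f (x t) \<bullet> q" if "q \<in> C" for q
      using min that by blast
    fix v
    assume v: "v \<in> vert C" "grad f (x t) \<bullet> v = grad f (x t) \<bullet> p"
    show "v \<in> Cstar"
    proof (rule ccontr)
      assume nv: "v \<notin> Cstar"
      have "grad f (x t) \<bullet> (v - x t) > 0"
      proof (rule inner_grad_pos_off_optimal_face[where C = C and L = L
              and \<alpha> = \<alpha>\<^sub>f and S = "real S" and xstar = xstar and \<kappa> = \<kappa>])
        show "v \<in> C"
          using v by (auto simp: vert_def extreme_point_of_def)
        show "grad f xstar \<bullet> (x t - xstar) \<ge> 0"
          using polytope_inner_nonneg[OF assms(1) opt_vert xC] that by blast
        show "grad f xstar \<bullet> (v - xstar) \<ge> \<kappa>"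
          using assms(15) v nv by blast
        show "f (x t) - f xstar < 8 * L * (diameter C)\<^sup>2 / real S"
          using hS that assms(2) h by metis
      qed (use sc sm \<alpha> \<alpha>L cvx bdd xs(1) xC that assms(2,3,14) S16 S2 in auto)
      \<comment> \<open>Since \<open>v\<close> has the same value as \<open>p\<close>, its inner
        product with the gradient relative to \<open>x t\<close> is at most that of
        \<open>xstar\<close>, hence at most \<open>- h t \<le> 0\<close>.\<close>
      moreover have "grad f (x t) \<bullet> p \<le> grad f (x t) \<bullet> xstar"
        using min xs(1) by blast
      ultimately show False
        using gap'[of t] h0[of t] v that by (simp add: inner_diff_right)
    qed
  qed

  \<comment> \<open>Decay of the distance to the affine hull of the face\<close>
  have decomp: "\<exists>u w. x t - xstar = u + w \<and> u \<in> W \<and> (\<forall>v\<in>W. orthogonal w v)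
      \<and> norm w \<le> \<beta> * (e t / e S)\<^sup>2" if "S \<le> t" "t \<le> T" for t
    using that
  proof (induction t rule: dec_induct)
    case base
    obtain u w where uw: "u \<in> W" "\<And>v. v \<in> W \<Longrightarrow> orthogonal w v" "x S - xstar = u + w"
      using orthogonal_subspace_decomp_exists[of W "x S - xstar"] W by (metis span_eq_iff)
    have "(norm (x S - xstar))\<^sup>2 = (norm u)\<^sup>2 + (norm w)\<^sup>2"
      unfolding uw using uw by (intro norm_add_Pythagorean) (simp add: orthogonal_commute)
    \<comment> \<open>Strong convexity at \<open>xstar\<close> turns the primal gap at
      \<open>S\<close> into a distance; the first argument of the maximum defining \<open>S\<close>
      is what makes it at most \<beta>.\<close>
    moreover have "(norm (x S - xstar))\<^sup>2 \<le> \<beta>\<^sup>2"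
    proof -
      have "f xstar + grad f xstar \<bullet> (x S - xstar) + \<alpha>\<^sub>f / 2 * (norm (xstar - x S))\<^sup>2 \<le> f (x S)"
        using sc xs(1) xC base by (auto simp: strongly_convex_over_def)
      moreover have "grad f xstar \<bullet> (x S - xstar) \<ge> 0"
        using polytope_inner_nonneg[OF assms(1) opt_vert xC] base by blast
      ultimately have "\<alpha>\<^sub>f / 2 * (norm (x S - xstar))\<^sup>2 \<le> h S"
        by (simp add: h norm_minus_commute)
      also have "\<dots> \<le> 8 * L * \<delta>\<^sup>2 / S"
        using hS[of S] base by simp
      also have "\<dots> \<le> \<alpha>\<^sub>f / 2 * \<beta>\<^sup>2"
        using S1 S16 \<alpha> \<open>\<beta> > 0\<close> by (simp add: field_simps)
      finally show ?thesis
        using \<alpha> by simp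
    qed
    ultimately have "(norm w)\<^sup>2 \<le> \<beta>\<^sup>2"
      using zero_le_power2[of "norm u"] by linarith
    then have "norm w \<le> \<beta>"
      using \<open>\<beta> > 0\<close> by (auto intro: power2_le_imp_le)
    with uw e[of S] show ?case
      by (intro exI[of _ u] exI[of _ w]) simp
  next
    case (step t)
    then obtain u w where uw: "x t - xstar = u + w" "u \<in> W" "\<forall>v\<in>W. orthogonal w v"
      "norm w \<le> \<beta> * (e t / e S)\<^sup>2"
      by auto
    obtain p where p: "p \<in> C" "\<forall>q\<in>C. grad f (x t) \<bullet> p \<le> grad f (x t) \<bullet> q"
      "x (Suc t) = (1 - e t) *\<^sub>R x t + e t *\<^sub>R p"
      using fw[of t] step.prems by auto
    have "p \<in> Cstar"
      using minF[OF _ _ p(1,2)] step by simp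
    \<comment> \<open>As \<open>p\<close> lies in the face, \<open>p - xstar\<close> is in
      \<open>W\<close>: the step alters the orthogonal part only by the factor
      \<open>1 - e t\<close>.\<close>
    have "x (Suc t) - xstar = (1 - e t) *\<^sub>R (x t - xstar) + e t *\<^sub>R (p - xstar)"
      by (simp add: p(3) algebra_simps)
    also have "\<dots> = ((1 - e t) *\<^sub>R u + e t *\<^sub>R (p - xstar)) + (1 - e t) *\<^sub>R w"
      unfolding uw by (simp add: scaleR_add_right)
    finally have "x (Suc t) - xstar = \<dots>" .
    moreover have "(1 - e t) *\<^sub>R u + e t *\<^sub>R (p - xstar) \<in> W"
      using W uw WF[OF \<open>p \<in> Cstar\<close>] by (intro subspace_add subspace_scale)
    moreover have "\<forall>v\<in>W. orthogonal ((1 - e t) *\<^sub>R w) v"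
      using uw by (auto simp: orthogonal_clauses)
    moreover have "norm ((1 - e t) *\<^sub>R w) \<le> \<beta> * (e (Suc t) / e S)\<^sup>2"
    proof -
      have "norm ((1 - e t) *\<^sub>R w) = (1 - e t) * norm w"
        using e[of t] by simp
      also have "\<dots> \<le> (1 - e t) * (\<beta> * (e t / e S)\<^sup>2)"
        using e[of t] uw by (intro mult_left_mono) auto
      also have "\<dots> = \<beta> * ((1 - e t) * (e t / e S)\<^sup>2)"
        by simp
      also have "\<dots> \<le> \<beta> * (e (Suc t) / e S)\<^sup>2"
        using open_loop_contraction[of t "e S"] \<open>\<beta> > 0\<close> unfolding e_def by (intro mult_left_mono) auto
      finally show ?thesis .
    qed
    ultimately show ?case
      by blast
  qed

  \<comment> \<open>Constants of the recursion\<close>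
  have M: "0 \<le> M"
    using assms(20) xs(1) norm_ge_zero order_trans by blast
  have A: "0 < A"
    using assms(25) \<alpha> \<open>\<beta> > 0\<close> by simp
  \<comment> \<open>The middle summand, rewritten through \<open>A\<close>, is the cost of the
    distance to the face.\<close>
  have B: "B = E + A * sqrt (\<beta> * M) / e S + L * \<beta>\<^sup>2 / (e S * 2)"
    unfolding assms(25,26,28) \<eta> by (simp add: real_sqrt_mult mult_ac)
  have B1: "E + A * sqrt (\<beta> * M) / e S \<le> B"
    using B L e[of S] by simp
  have "0 \<le> A * sqrt (\<beta> * M) / e S"
    using A M \<open>\<beta> > 0\<close> e[of S] by simp
  with B1 E have B0: "0 \<le> B"
    by linarith
  define K where "K = Max {h S / (\<eta> (int S - 1))\<^sup>2, B\<^sup>2 / A\<^sup>2 + B, D / (\<eta> (int S))\<^sup>2 + E}"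
  have K1: "h S / (\<eta> (int S - 1))\<^sup>2 \<le> K" and K2: "B\<^sup>2 / A\<^sup>2 + B \<le> K"
    by (simp_all add: K_def)
  have "0 \<le> B\<^sup>2 / A\<^sup>2"
    by simp
  with K2 B0 have K0: "0 \<le> K"
    by linarith

  \<comment> \<open>Accelerated recursion from \<open>S\<close> on\<close>
  have rec: "h (Suc t) \<le> (1 - 2 / (real t + 4)) * h t - 4 / (real t + 4) * A * sqrt (h t) + (4 / (real t + 4))\<^sup>2 * B"
    if t: "S \<le> t" "t < T" for t :: nat
  proof -
    obtain p where p: "p \<in> C" "\<forall>q\<in>C. grad f (x t) \<bullet> p \<le> grad f (x t) \<bullet> q"
      "x (Suc t) = (1 - e t) *\<^sub>R x t + e t *\<^sub>R p"
      using fw[OF t(2)] by blast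
    obtain u w where uw: "x t - xstar = u + w" "u \<in> W" "\<forall>v\<in>W. orthogonal w v"
      "norm w \<le> \<beta> * (e t / e S)\<^sup>2"
      using decomp[of t] t by auto
    have "h t + A * (sqrt (h t) - sqrt (\<beta> * M) * (e t / e S)) \<le> grad f (x t) \<bullet> (x t - p)"
      unfolding h \<open>A = _\<close>
    proof (rule gap_lower_bound_near_face[where C = C and W = W and u = u and w = w])
      show "norm (grad f (x t)) \<le> M"
        using assms(20) xC t by simp
      show "0 \<le> f (x t) - f xstar"
        using h0[of t] h t by simp
    qed (use sc \<alpha> xC xs(1) t W ball \<open>\<beta> > 0\<close> p uw e[of t] e[of S] in auto)
    then have "e t * (h t + A * (sqrt (h t) - sqrt (\<beta> * M) * (e t / e S)))
        \<le> e t * (grad f (x t) \<bullet> (x t - p))"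
      using e[of t] by (intro mult_left_mono) auto
    with progress[OF t(2) p(1,3)]
    \<comment> \<open>The face-distance error carries \<open>e t\<close> twice, once from the step
      and once from the ratio \<open>e t / e S\<close>, so it joins \<open>E\<close> at order
      \<open>(e t)^2\<close>.\<close>
    have "h (Suc t) \<le> (1 - e t) * h t - e t * A * sqrt (h t) + (e t)\<^sup>2 * (E + A * sqrt (\<beta> * M) / e S)"
      by (simp add: algebra_simps power2_eq_square)
    \<comment> \<open>The contraction is weakened, using \<open>h t \<ge> 0\<close>, to the factor
      matching the product invariant.\<close>
    also have "\<dots> \<le> (1 - e t / 2) * h t - e t * A * sqrt (h t) + (e t)\<^sup>2 * B"
      using e[of t] h0[of t] B1 t by (intro add_mono diff_right_mono mult_right_mono mult_left_mono) auto
    also have "e t / 2 = 2 / (real t + 4)"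
      unfolding e_def by (simp add: divide_simps)
    finally show ?thesis
      by (simp add: e_def)
  qed

  \<comment> \<open>Initial value and conclusion\<close>
  have init: "h S \<le> 4 / (real S + 2) * (4 / (real S + 3)) * K"
  proof -
    have \<eta>S: "\<eta> (int S - 1) = 4 / (real S + 3)"
      using assms(22) by simp
    have "h S = (\<eta> (int S - 1))\<^sup>2 * (h S / (\<eta> (int S - 1))\<^sup>2)"
      by (simp add: \<eta>S)
    also have "\<dots> \<le> (\<eta> (int S - 1))\<^sup>2 * K"
      using K1 by (intro mult_left_mono) auto
    also have "\<dots> = 4 / (real S + 3) * (4 / (real S + 3)) * K"
      by (simp add: \<eta>S power2_eq_square)
    \<comment> \<open>One factor 4/(S+3) is enlarged so that the square at index S - 1 fits under
      the product invariant.\<close>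
    also have "\<dots> \<le> 4 / (real S + 2) * (4 / (real S + 3)) * K"
      using K0 by (intro mult_right_mono) (auto simp: frac_le)
    finally show ?thesis .
  qed
  show ?thesis
  proof
    fix t
    assume "t \<in> {S..T}"
    then have t: "S \<le> t" "t \<le> T"
      by auto
    have "h t \<le> 4 / (real t + 2) * (4 / (real t + 3)) * K"
      using open_loop_accelerated_rate[OF rec h0 A B0 K2 init t] .
    \<comment> \<open>Enlarging 4/(t+3) to 4/(t+2) gives the square of the step-size at t -
      2.\<close>
    also have "\<dots> \<le> 4 / (real t + 2) * (4 / (real t + 2)) * K"
      using K0 by (intro mult_right_mono mult_left_mono) (auto simp: frac_le)
    also have "\<dots> = (\<eta> (int t - 2))\<^sup>2 * K"
      using assms(22) by (simp add: power2_eq_square add.commute)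
    finally show "h t \<le> (\<eta> (int t - 2))\<^sup>2 *
        Max {h S / (\<eta> (int S - 1))\<^sup>2, B\<^sup>2 / A\<^sup>2 + B, D / (\<eta> (int S))\<^sup>2 + E}"
      unfolding K_def .
  qed
qed

end
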